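(* Let $\mathcal G\subset\Delta$ be the Rauzy gasket. Then its Hausdorff dimension satisfies $\dim_H(\mathcal G)\le 1.7415$.
   Context: Let $\Delta=\{(x_1,x_2,x_3)\in\mathbb R^3 : x_1,x_2,x_3\ge 0,\ x_1+x_2+x_3=1\}$, with the Euclidean metric of $\mathbb R^3$. Define $T_1,T_2,T_3:\Delta\to\Delta$ by $$T_1(x)=\Big(\tfrac{1}{2-x_1},\tfrac{x_2}{2-x_1},\tfrac{x_3}{2-x_1}\Big),\quad T_2(x)=\Big(\tfrac{x_1}{2-x_2},\tfrac{1}{2-x_2},\tfrac{x_3}{2-x_2}\Big),\quad T_3(x)=\Big(\tfrac{x_1}{2-x_3},\tfrac{x_2}{2-x_3},\tfrac{1}{2-x_3}\Big).$$ The Rauzy gasket $\mathcal G$ is the limit set of this iterated function scheme, i.e. the smallest non-empty closed set $\mathcal G\subset\Delta$ with $\mathcal G=\bigcup_{j=1}^3T_j(\mathcal G)$. *)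

theory Defs
  imports "HOL-Analysis.Analysis"
begin

text \<open>The summand \<open>(diam U)\<^sup>s\<close> in the definition of Hausdorff measure. In HOL
  \<open>0 powr 0 = 0\<close>, whereas here one needs \<open>(diam U)\<^sup>0 = 1\<close> for every nonempty \<open>U\<close>,
  and \<open>0\<close> for the empty set.\<close>

definition diam_powr :: "real \<Rightarrow> 'a::metric_space set \<Rightarrow> real" where
  "diam_powr s U = (if U = {} then 0 else if s = 0 then 1 else diameter U powr s)"

text \<open>Boundedness of the covering sets is required explicitly because \<^const>\<open>diameter\<close> is
  real-valued and unspecified on unbounded sets. Members of the cover may be empty, so finite covers
  are included.\<close>

definition hausdorff_premeasure :: "real \<Rightarrow> real \<Rightarrow> 'a::metric_space set \<Rightarrow> ennreal" where
  "hausdorff_premeasure s \<delta> S =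
     (INF U \<in> {U :: nat \<Rightarrow> 'a set. S \<subseteq> (\<Union>i. U i) \<and> (\<forall>i. bounded (U i) \<and> diameter (U i) \<le> \<delta>)}.
        \<Sum>i. ennreal (diam_powr s (U i)))"

definition hausdorff_measure :: "real \<Rightarrow> 'a::metric_space set \<Rightarrow> ennreal" where
  "hausdorff_measure s S = (SUP \<delta> \<in> {0<..}. hausdorff_premeasure s \<delta> S)"

definition hausdorff_dim :: "'a::metric_space set \<Rightarrow> ereal" where
  "hausdorff_dim S = (INF s \<in> {s. 0 \<le> s \<and> hausdorff_measure s S = 0}. ereal s)"

definition std_simplex :: "(real^3) set" where
  "std_simplex = {x. x$1 \<ge> 0 \<and> x$2 \<ge> 0 \<and> x$3 \<ge> 0 \<and> x$1 + x$2 + x$3 = 1}"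

definition rauzy_map :: "3 \<Rightarrow> real^3 \<Rightarrow> real^3" where
  "rauzy_map j x = (\<chi> i. (if i = j then 1 else x$i) / (2 - x$j))"

text \<open>The order on sets is inclusion, so \<open>LEAST\<close> is the smallest set with the given property.
  It exists: any such set contains the three vertices, since the iterates of \<^term>\<open>rauzy_map j\<close>
  converge on the simplex to the \<open>j\<close>-th vertex, a fixed point; and the closure of the union of
  the orbits of the vertices under the semigroup generated by the three maps has the property.\<close>

definition rauzy_gasket :: "(real^3) set" where
  "rauzy_gasket =
     (LEAST G. G \<noteq> {} \<and> closed G \<and> G \<subseteq> std_simplex \<and> G = (\<Union>j\<in>UNIV. rauzy_map j ` G))"

end

theory Submission
  imports Defs
begin

text \<open>The maps are projective: a word corresponds to a unimodular matrix with columns \<open>a, b, c\<close>, and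
  appending the first letter replaces them by \<open>a, a + b, a + c\<close>. Let \<open>x, y, z\<close> be the column sums and \<open>s\<close>
  their total. The image triangle has area of order \<open>1 / (x y z)\<close>, and its edges turn out to have length at
  most \<open>2 / max x y\<close> and so on, so its diameter is \<open>O(1 / s)\<close>. Cutting it into pieces of the size of its
  height costs, in dimension \<open>d = 1.7415\<close>, at most a constant times \<open>s powr (1 - t) / min x y z\<close> with
  \<open>t = 2 d - 1 = 2.483\<close>. This is dominated by an explicit function of \<open>s\<close> and \<open>min x y z\<close> whose values at
  the three children sum to at most its value at the parent. Hence the total cost of the covers by words
  of length \<open>k\<close> stays bounded while the diameters tend to \<open>0\<close>.\<close>

section \<open>A superharmonic function\<close>

text \<open>The cubics in the next two lemmas are numerical fits \<open>U\<close> for which the derivative of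
  \<open>U y * (1 \<plusminus> y) powr 0.483\<close> has an almost equioscillating polynomial factor; hence its near-double root
  at \<open>1/8\<close>, respectively \<open>1/16\<close>.\<close>

lemma powr_one_plus_le:
  fixes y :: real
  assumes "0 \<le> y" "y \<le> 1/2"
  shows "(1 + y) powr (-0.483) \<le> 1 - 0.479*y + 0.3205*y^2 - 0.1415*y^3"
proof -
  define U where "U = (\<lambda>y::real. 1 - 0.479*y + 0.3205*y^2 - 0.1415*y^3)"
  define U' where "U' = (\<lambda>y::real. - 0.479 + 0.641*y - 0.4245*y^2)"
  \<comment> \<open>The claim amounts to \<open>1 \<le> U y * (1 + y) powr 0.483\<close>, an
    equality at \<open>y = 0\<close>, so monotonicity suffices.\<close>
  have "U 0 * (1 + 0) powr 0.483 \<le> U y * (1 + y) powr 0.483"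
  proof (rule DERIV_nonneg_imp_nondecreasing[OF assms(1)])
    fix x :: real assume x: "0 \<le> x" "x \<le> y"
    define D where "D = U' x * (1 + x) powr 0.483 + U x * (0.483 * (1 + x) powr (0.483 - 1))"
    have "((\<lambda>y. U y * (1 + y) powr 0.483) has_real_derivative D) (at x)"
      unfolding U_def U'_def D_def using x
      by (auto intro!: derivative_eq_intros simp: field_simps power2_eq_square)
    moreover have "D = (1 + x) powr (0.483 - 1) * (U' x * (1 + x) + 0.483 * U x)"
    proof -
      define E where "E = (1 + x) powr (0.483 - 1)"
      have E: "(1 + x) powr 0.483 = E * (1 + x)"
        using x powr_add[of "1 + x" "0.483 - 1" 1] by (simp add: E_def)
      show ?thesis unfolding D_def E unfolding E_def[symmetric] by (simp add: algebra_simps)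
    qed
    moreover have "U' x * (1 + x) + 0.483 * U x = 985689/2000000 * ((1/2 - x) * (x - 1/8)^2)
        + (38311/256000000 - 1299/25600000 * x + 2669/1600000 * x^2)"
      unfolding U_def U'_def by (simp add: field_simps power2_eq_square power3_eq_cube)
    moreover have "0 \<le> 985689/2000000 * ((1/2 - x) * (x - 1/8)^2)"
      using x assms by (intro mult_nonneg_nonneg) auto
    \<comment> \<open>On \<open>[0, 1/2]\<close> the constant term of the remainder outweighs the
      negative linear one.\<close>
    moreover have "0 \<le> 38311/256000000 - 1299/25600000 * x + 2669/1600000 * x^2"
      using x assms zero_le_power2[of x] by linarith
    ultimately show "\<exists>D. ((\<lambda>y. U y * (1 + y) powr 0.483) has_real_derivative D) (at x) \<and> 0 \<le> D"
      using x by (intro exI[of _ D]) auto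
  qed
  then have "1 \<le> U y * (1 + y) powr 0.483" by (simp add: U_def)
  moreover have "0 < (1 + y) powr 0.483" using assms by simp
  ultimately show ?thesis
    using assms unfolding powr_minus U_def[symmetric] by (simp add: field_simps U_def)
qed

lemma powr_one_minus_le:
  fixes y :: real
  assumes "0 \<le> y" "y \<le> 1/4"
  shows "(1 - y) powr (-0.483) \<le> 1 + 0.4847*y + 0.33*y^2 + 0.484*y^3"
proof -
  define U where "U = (\<lambda>y::real. 1 + 0.4847*y + 0.33*y^2 + 0.484*y^3)"
  define U' where "U' = (\<lambda>y::real. 0.4847 + 0.66*y + 1.452*y^2)"
  have "U 0 * (1 - 0) powr 0.483 \<le> U y * (1 - y) powr 0.483"
  proof (rule DERIV_nonneg_imp_nondecreasing[OF assms(1)])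
    fix x :: real assume x: "0 \<le> x" "x \<le> y"
    define D where "D = U' x * (1 - x) powr 0.483 - U x * (0.483 * (1 - x) powr (0.483 - 1))"
    have "((\<lambda>y. U y * (1 - y) powr 0.483) has_real_derivative D) (at x)"
      unfolding U_def U'_def D_def using x assms
      by (auto intro!: derivative_eq_intros simp: field_simps power2_eq_square)
    moreover have "D = (1 - x) powr (0.483 - 1) * (U' x * (1 - x) - 0.483 * U x)"
    proof -
      define E where "E = (1 - x) powr (0.483 - 1)"
      have E: "(1 - x) powr 0.483 = E * (1 - x)"
        using x assms powr_add[of "1 - x" "0.483 - 1" 1] by (simp add: E_def)
      show ?thesis unfolding D_def E unfolding E_def[symmetric] by (simp add: algebra_simps)
    qed
    moreover have "U' x * (1 - x) - 0.483 * U x = 421443/250000 * ((1/4 - x) * (x - 1/16)^2)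
        + (13757/256000000 + 145703/320000000 * x + 891/2000000 * x^2)"
      unfolding U_def U'_def by (simp add: field_simps power2_eq_square power3_eq_cube)
    moreover have "0 \<le> 421443/250000 * ((1/4 - x) * (x - 1/16)^2)"
      using x assms by (intro mult_nonneg_nonneg) auto
    moreover have "0 \<le> 13757/256000000 + 145703/320000000 * x + 891/2000000 * x^2"
      using x by (intro add_nonneg_nonneg mult_nonneg_nonneg) auto
    ultimately show "\<exists>D. ((\<lambda>y. U y * (1 - y) powr 0.483) has_real_derivative D) (at x) \<and> 0 \<le> D"
      using x by (intro exI[of _ D]) auto
  qed
  then have "1 \<le> U y * (1 - y) powr 0.483" by (simp add: U_def)
  moreover have "0 < (1 - y) powr 0.483" using assms by simp
  ultimately show ?thesis
    using assms unfolding powr_minus U_def[symmetric] by (simp add: field_simps U_def)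
qed

text \<open>The fraction \<open>14/29\<close> is a convergent of \<open>0.483\<close> from below,
  and \<open>0.716 = 179/250\<close>, so raising to the power 29 leaves an inequality between
  integers.\<close>

lemma two_powr_le: "2 powr (-0.483) \<le> (0.716::real)"
proof -
  have frac: "1 / a \<le> b / c" if "c \<le> b * a" "0 < a" "0 < c" for a b c :: real
    using that by (simp add: field_simps)
  have "(250::real)^29 \<le> 179^29 * 2^14" by simp
  then have "(1/2::real)^14 \<le> (179/250)^29"
    unfolding power_divide power_one by (rule frac) (simp_all only: zero_less_power zero_less_numeral)
  moreover have "(2 powr (-14/29) :: real)^29 = (1/2)^14"
    by (simp add: powr_power powr_neg_numeral power_divide)
  ultimately have "(2 powr (-14/29) :: real)^29 \<le> (179/250)^29" by (simp only:)
  then have "2 powr (-14/29) \<le> (179/250 :: real)"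
    by (rule power_mono_iff[THEN iffD1, rotated -1]) simp_all
  moreover have "2 powr (-0.483) \<le> (2 powr (-14/29) :: real)" by (rule powr_mono) auto
  ultimately have "2 powr (-0.483) \<le> (179/250 :: real)" by (rule order_trans[rotated])
  then show ?thesis by simp
qed

text \<open>The value of \<open>potential\<close>, defined below, at the child that keeps a column
  of mass \<open>y\<close>, for \<open>s = 1\<close> and \<open>q = 1 - 2*y\<close>. Thus
  \<open>q = 0\<close> is the degenerate case \<open>2*y = s\<close>.\<close>

definition branch_weight :: "real \<Rightarrow> real" where
  "branch_weight q = (2 - q) powr (-0.483) * (1 - q) powr (-1) + (2 - q) powr (-2.483) / 8"

lemma convex_on_diff_powr:
  fixes c p :: real
  assumes "0 \<le> p"
  shows "convex_on {..<c} (\<lambda>q. (c - q) powr (- p))"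
proof (rule f''_ge0_imp_convex)
  fix x assume x: "x \<in> {..<c}"
  show "((\<lambda>q. (c - q) powr (- p)) has_real_derivative p * (c - x) powr (- p - 1)) (at x)"
    using x by (auto intro!: derivative_eq_intros simp: field_simps)
  show "((\<lambda>q. p * (c - q) powr (- p - 1)) has_real_derivative p * (p + 1) * (c - x) powr (- p - 2)) (at x)"
    using x by (auto intro!: derivative_eq_intros simp: algebra_simps)
  show "0 \<le> p * (p + 1) * (c - x) powr (- p - 2)" using assms by simp
qed simp

text \<open>A product of nonnegative nondecreasing convex functions is convex, and both factors of
  the first term increase with \<open>q\<close>.\<close>

lemma convex_on_branch_weight: "convex_on {..<1} branch_weight"
proof -
  have mono: "mono_on {..<1} (\<lambda>q. (c - q) powr (- p))" if "1 \<le> c" "0 \<le> p" for c p :: real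
    using that by (auto intro!: mono_onI powr_mono2')
  have "convex_on {..<1::real} (\<lambda>q. (2 - q) powr (- p))" if "0 \<le> p" for p
    using convex_on_diff_powr[OF that, of 2] by (rule convex_on_subset) auto
  note two = this
  have "convex_on {..<1} (\<lambda>q::real. (2 - q) powr (- 0.483) * (1 - q) powr (- 1))"
    by (intro convex_on_mul two convex_on_diff_powr mono) auto
  moreover have "convex_on {..<1} (\<lambda>q::real. (1/8) * (2 - q) powr (- 2.483))"
    by (intro convex_on_cmul two) auto
  ultimately have "convex_on {..<1}
      (\<lambda>q::real. (2 - q) powr (- 0.483) * (1 - q) powr (- 1) + (1/8) * (2 - q) powr (- 2.483))"
    by (rule convex_on_add)
  then show ?thesis by (simp add: branch_weight_def[abs_def])
qed

text \<open>\<open>q\<close> and \<open>r\<close> are convex combinations of \<open>0\<close> and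
  \<open>q + r\<close> with complementary weights, so the two convexity bounds add up to the
  endpoint values.\<close>

lemma branch_weight_superadditive:
  assumes "0 \<le> q" "0 \<le> r" "q + r < 1"
  shows "branch_weight q + branch_weight r \<le> branch_weight 0 + branch_weight (q + r)"
proof (cases "q + r = 0")
  case True
  then have "q = 0" "r = 0" using assms by auto
  then show ?thesis by simp
next
  case False
  define u where "u = q / (q + r)"
  have u: "0 \<le> u" "u \<le> 1" "u * (q + r) = q" "(1 - u) * (q + r) = r"
    using assms False by (auto simp: u_def field_simps)
  have "branch_weight q \<le> (1 - u) * branch_weight 0 + u * branch_weight (q + r)"
    using convex_onD[OF convex_on_branch_weight u(1,2), of 0 "q + r"] assms u(3) by simp
  moreover have "branch_weight r \<le> (1 - (1 - u)) * branch_weight 0 + (1 - u) * branch_weight (q + r)"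
    using convex_onD[OF convex_on_branch_weight, of "1 - u" 0 "q + r"] assms u by simp
  ultimately show ?thesis by (simp add: algebra_simps)
qed

text \<open>The first summand is \<open>branch_weight (1 - y)\<close>, so this compares three
  children in degenerate position with their parent. As \<open>y\<close> tends to \<open>0\<close>
  the poles \<open>1/y\<close> cancel and only a small margin remains, hence the sharp cubic bounds;
  they leave a polynomial inequality.\<close>

lemma central_inequality:
  fixes y :: real
  assumes "0 < y" "y \<le> 1/2"
  shows "(1 + y) powr (-0.483) * (1/y + 1/(8 * (1 + y)^2)) + branch_weight 0 + branch_weight y
      \<le> 1 / (y * (1 - y)) + 1/8"
proof -
  define X where "X = 1 - 0.479*y + 0.3205*y^2 - 0.1415*y^3"
  define Z where "Z = 0.716 * (1 + 0.4847*(y/2) + 0.33*(y/2)^2 + 0.484*(y/2)^3)"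
  have X: "(1 + y) powr (-0.483) \<le> X"
    using powr_one_plus_le assms by (simp add: X_def)
  have split: "(2 - q) powr (-2.483) = (2 - q) powr (-0.483) / (2 - q)^2" if "q < 2" for q :: real
    using that powr_diff[of "2 - q" "-0.483" 2] by (simp add: powr_numeral)
  \<comment> \<open>Taking out the factor \<open>2\<close> leaves \<open>y/2 \<le> 1/4\<close>, the
    range of \<open>powr_one_minus_le\<close>.\<close>
  have "(2 - y) powr (-0.483) = (2 * (1 - y/2)) powr (-0.483)" by simp
  also have "\<dots> = 2 powr (-0.483) * (1 - y/2) powr (-0.483)"
    using assms by (subst powr_mult) auto
  also have "\<dots> \<le> Z"
    unfolding Z_def using powr_one_minus_le[of "y/2"] assms two_powr_le by (intro mult_mono) auto
  finally have Z: "(2 - y) powr (-0.483) \<le> Z" .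
  have "branch_weight y = (2 - y) powr (-0.483) * (1/(1 - y) + 1/(8 * (2 - y)^2))"
  proof -
    have "(2 - y) powr (-2.483) = (2 - y) powr (-0.483) / (2 - y)^2"
      and "(1 - y) powr (-1) = 1 / (1 - y)"
      using split[of y] assms by (simp_all add: powr_minus_divide)
    then show ?thesis unfolding branch_weight_def by (simp only:) (simp add: distrib_left)
  qed
  also have "\<dots> \<le> Z * (1/(1 - y) + 1/(8 * (2 - y)^2))"
    using Z assms by (intro mult_right_mono) auto
  finally have bw: "branch_weight y \<le> Z * (1/(1 - y) + 1/(8 * (2 - y)^2))" .
  have "branch_weight 0 = 2 powr (-0.483) * (33/32)"
    unfolding branch_weight_def using split[of 0] by simp
  then have bw0: "branch_weight 0 \<le> 0.716 * (33/32)" using two_powr_le by simp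
  have child: "(1 + y) powr (-0.483) * (1/y + 1/(8 * (1 + y)^2)) \<le> X * (1/y + 1/(8 * (1 + y)^2))"
    using X assms by (intro mult_right_mono) auto
  \<comment> \<open>Bernstein form on \<open>[0, 1/2]\<close> of the numerator left after clearing denominators.\<close>
  define P where "P = 144/125*(y^0*(1/2-y)^7) + 16568771/625000*(y^1*(1/2-y)^6)
      + 109402473/1250000*(y^2*(1/2-y)^5) + 12133791/100000*(y^3*(1/2-y)^4)
      + 441775841/5000000*(y^4*(1/2-y)^3) + 184601521/5000000*(y^5*(1/2-y)^2)
      + 90336399/10000000*(y^6*(1/2-y)^1) + 11097207/10000000*(y^7*(1/2-y)^0)"
  have "0 \<le> P"
    unfolding P_def using assms by (intro add_nonneg_nonneg mult_nonneg_nonneg zero_le_power) auto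
  \<comment> \<open>\<open>v\<close> and \<open>w\<close> only serve the polynomial identities:
    \<open>200\<close> absorbs powers of 2 and 5 from the decimal coefficients, and \<open>w\<close>
    moves the Bernstein basis to \<open>[0, 1]\<close>.\<close>
  define v where "v = y / 200"
  have v: "y = 200 * v" by (simp add: v_def)
  define w where "w = 2 * y"
  have w: "y = w / 2" "1/2 - y = (1 - w) / 2" by (auto simp: w_def field_simps)
  have poly_P: "P = 9/1000 + 11528771/40000000*y - 59182779/40000000*y^2 + 20529261/8000000*y^3
      - 58286799/40000000*y^4 - 4697551/10000000*y^5 + 3041173/4000000*y^6 - 92409/500000*y^7"
    unfolding P_def w(2) unfolding w(1) by (simp add: power_divide, simp add: divide_simps, algebra)
  \<comment> \<open>The factor \<open>y\<close> on the left reflects the cancelled poles.\<close>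
  have poly: "y * P = (1 + y)^2 * (2 - y)^2 + 1/8 * (y * (1 - y) * (1 + y)^2 * (2 - y)^2)
      - X * ((1 - y) * (1 + y)^2 * (2 - y)^2 + 1/8 * (y * (1 - y) * (2 - y)^2))
      - Z * (y * (1 + y)^2 * (2 - y)^2 + 1/8 * (y * (1 - y) * (1 + y)^2))
      - 0.716 * (33/32) * (y * (1 - y) * (1 + y)^2 * (2 - y)^2)"
    unfolding poly_P X_def Z_def unfolding v
    by (simp add: power_divide, simp add: divide_simps, algebra)
  have "1 / (y * (1 - y)) + 1/8 - X * (1/y + 1/(8 * (1 + y)^2)) - Z * (1/(1 - y) + 1/(8 * (2 - y)^2))
      - 0.716 * (33/32) = y * P / (y * (1 - y) * (1 + y)^2 * (2 - y)^2)"
  proof -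
    define A B C where "A = 1 - y" and "B = (1 + y)^2" and "C = (2 - y)^2"
    have "A \<noteq> 0" "B \<noteq> 0" "C \<noteq> 0" "y \<noteq> 0" using assms by (auto simp: A_def B_def C_def)
    then show ?thesis
      unfolding poly unfolding A_def[symmetric] B_def[symmetric] C_def[symmetric]
      by (simp add: field_simps)
  qed
  also have "\<dots> \<ge> 0" using \<open>0 \<le> P\<close> assms by auto
  finally show ?thesis using bw bw0 child by linarith
qed

text \<open>In the application \<open>s\<close> is the total and \<open>m\<close> the least of the three column masses. The exponent is
  \<open>2 * 1.7415 - 1\<close>; the first summand has the blow-up forced by the parabolic fixed points, and the
  constant \<open>1/8\<close> was found numerically.\<close>

definition potential :: "real \<Rightarrow> real \<Rightarrow> real" where
  "potential s m = s powr (-2.483) * (s^2 / (2 * m * (s - 2 * m)) + 1/8)"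

text \<open>Scaling to \<open>s = 1\<close> turns the three children into \<open>branch_weight\<close> terms; by convexity the worst
  position of \<open>y\<close> and \<open>z\<close> is the degenerate one \<open>2 * y = s\<close>, leaving an inequality in \<open>2 * x / s\<close> alone.\<close>

lemma potential_superharmonic:
  assumes "0 < x" "0 < y" "0 < z" "x + y + z = s" "4 * x \<le> s" "2 * y \<le> s" "2 * z \<le> s"
  shows "potential (s + 2*x) x + potential (s + 2*y) y + potential (s + 2*z) z \<le> potential s x"
proof -
  have s: "0 < s" using assms by linarith
  \<comment> \<open>\<open>q\<close> and \<open>r\<close> measure how far \<open>y\<close> and
    \<open>z\<close> are from degeneracy; \<open>x + y + z = s\<close> makes their sum equal to
    \<open>Y\<close>.\<close>
  define Y q r where "Y = 2*x/s" and "q = 1 - 2*y/s" and "r = 1 - 2*z/s"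
  have Y: "0 < Y" "Y \<le> 1/2" using assms s by (auto simp: Y_def field_simps)
  have qr: "0 \<le> q" "0 \<le> r" "q + r = Y"
    using assms s by (auto simp: Y_def q_def r_def field_simps)
  have pw: "u powr (-2.483) * u^2 = u powr (-0.483)" if "0 < u" for u :: real
    using that powr_add[of u "-2.483" 2] by (simp add: powr_numeral)
  have child: "potential (s + 2*y) y = s powr (-2.483) * branch_weight (1 - 2*y/s)" if "0 < y" for y
  proof -
    have "branch_weight (1 - 2*y/s) = (1 + 2*y/s) powr (-2.483) * ((1 + 2*y/s)^2 / (2*y/s) + 1/8)"
      unfolding branch_weight_def using that s pw[of "1 + 2*y/s"]
      by (simp add: powr_minus field_simps)
    moreover have "s powr (-2.483) * (1 + 2*y/s) powr (-2.483) = (s + 2*y) powr (-2.483)"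
    proof -
      have "s + 2*y = s * (1 + 2*y/s)" using s by (simp add: field_simps)
      then show ?thesis using that s by (simp only: powr_mult)
    qed
    moreover have "(1 + 2*y/s)^2 / (2*y/s) = (s + 2*y)^2 / (2 * y * s)"
      using that s by (simp add: field_simps power2_eq_square)
    ultimately show ?thesis unfolding potential_def by (simp add: mult.assoc[symmetric])
  qed
  have "potential s x = s powr (-2.483) * (1 / (Y * (1 - Y)) + 1/8)"
    unfolding potential_def Y_def using assms s by (simp add: field_simps power2_eq_square)
  moreover have "potential (s + 2*x) x
      = s powr (-2.483) * ((1 + Y) powr (-0.483) * (1/Y + 1/(8 * (1 + Y)^2)))"
  proof -
    have "(1 + Y) powr (-0.483) * (1/Y + 1/(8 * (1 + Y)^2))
        = (1 + Y) powr (-2.483) * ((1 + Y)^2 / Y + 1/8)"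
      using Y pw[of "1 + Y"] by (simp add: field_simps)
    moreover have "(1 + Y)^2 / Y = (s + 2*x)^2 / (2 * x * s)"
      using assms(1) s unfolding Y_def by (simp add: field_simps power2_eq_square)
    moreover have "s powr (-2.483) * (1 + Y) powr (-2.483) = (s + 2*x) powr (-2.483)"
    proof -
      have "s + 2*x = s * (1 + Y)" using s by (simp add: Y_def field_simps)
      then show ?thesis using Y s by (simp only: powr_mult)
    qed
    ultimately show ?thesis unfolding potential_def by (simp add: mult.assoc[symmetric])
  qed
  moreover have "(1 + Y) powr (-0.483) * (1/Y + 1/(8 * (1 + Y)^2)) + branch_weight q + branch_weight r
      \<le> 1 / (Y * (1 - Y)) + 1/8"
    using central_inequality[OF Y] branch_weight_superadditive[of q r] qr Y by simp
  ultimately show ?thesis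
    using child[OF assms(2)] child[OF assms(3)] s
    unfolding q_def[symmetric] r_def[symmetric]
    by (simp add: distrib_left[symmetric] add.assoc mult_left_mono del: powr_gt_zero)
qed

section \<open>Hausdorff dimension from finite covers\<close>

text \<open>Lists rather than sets: appending two covers adds their costs exactly, repetitions
  included.\<close>

definition has_cover :: "real \<Rightarrow> real \<Rightarrow> real \<Rightarrow> 'a::metric_space set \<Rightarrow> bool" where
  "has_cover s \<delta> c S \<longleftrightarrow> (\<exists>Us. S \<subseteq> \<Union>(set Us) \<and> (\<forall>U\<in>set Us. bounded U \<and> diameter U \<le> \<delta>) \<and>
     (\<Sum>U\<leftarrow>Us. diam_powr s U) \<le> c)"

lemma has_cover_mono:
  assumes "has_cover s \<delta> c T" "S \<subseteq> T" "\<delta> \<le> \<delta>'" "c \<le> c'"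
  shows "has_cover s \<delta>' c' S"
  using assms unfolding has_cover_def by (meson order_trans)

lemma has_cover_Un:
  assumes "has_cover s \<delta> c S" "has_cover s \<delta> d T"
  shows "has_cover s \<delta> (c + d) (S \<union> T)"
proof -
  obtain Us Vs where "S \<subseteq> \<Union>(set Us)" "\<forall>U\<in>set Us. bounded U \<and> diameter U \<le> \<delta>"
    "(\<Sum>U\<leftarrow>Us. diam_powr s U) \<le> c" "T \<subseteq> \<Union>(set Vs)" "\<forall>U\<in>set Vs. bounded U \<and> diameter U \<le> \<delta>"
    "(\<Sum>U\<leftarrow>Vs. diam_powr s U) \<le> d"
    using assms unfolding has_cover_def by metis
  then show ?thesis
    unfolding has_cover_def by (intro exI[of _ "Us @ Vs"]) auto
qed

lemma diam_powr_nonneg: "0 \<le> diam_powr s U"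
  by (simp add: diam_powr_def)

text \<open>Raising the exponent from \<open>s\<close> to \<open>s'\<close> multiplies each summand
  by at most \<open>\<delta> powr (s' - s)\<close>.\<close>

lemma hausdorff_premeasure_le_if_has_cover:
  assumes cover: "has_cover s \<delta> c S" and "0 < s" "s < s'" "0 \<le> \<delta>" "\<delta> \<le> \<epsilon>"
  shows "hausdorff_premeasure s' \<epsilon> S \<le> ennreal (\<delta> powr (s' - s) * c)"
proof -
  obtain Us where Us: "S \<subseteq> \<Union>(set Us)" "\<forall>U\<in>set Us. bounded U \<and> diameter U \<le> \<delta>"
    "(\<Sum>U\<leftarrow>Us. diam_powr s U) \<le> c"
    using cover unfolding has_cover_def by metis
  \<comment> \<open>Padding with empty sets, which cost \<open>0\<close> and have diameter
    \<open>0\<close>, turns the list into the required sequence.\<close>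
  define V where "V i = (if i < length Us then Us ! i else {})" for i
  have "S \<subseteq> (\<Union>i. V i)"
  proof
    fix x assume "x \<in> S"
    then obtain i where "i < length Us" "x \<in> Us ! i"
      using Us(1) by (metis Union_iff in_set_conv_nth subsetD)
    then show "x \<in> (\<Union>i. V i)" by (auto simp: V_def intro!: exI[of _ i])
  qed
  moreover have "bounded (V i) \<and> diameter (V i) \<le> \<delta>" for i
    using Us(2) assms by (simp add: V_def)
  ultimately have "hausdorff_premeasure s' \<epsilon> S \<le> (\<Sum>i. ennreal (diam_powr s' (V i)))"
    unfolding hausdorff_premeasure_def using \<open>\<delta> \<le> \<epsilon>\<close> by (intro INF_lower) (auto intro: order_trans)
  also have "\<dots> = (\<Sum>i<length Us. ennreal (diam_powr s' (V i)))"
    by (rule suminf_finite) (auto simp: V_def diam_powr_def)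
  also have "\<dots> = ennreal (\<Sum>i<length Us. diam_powr s' (V i))"
    by (rule sum_ennreal) (rule diam_powr_nonneg)
  also have "\<dots> \<le> ennreal (\<delta> powr (s' - s) * c)"
  proof (rule ennreal_leI)
    have "diam_powr s' U \<le> \<delta> powr (s' - s) * diam_powr s U" if "U \<in> set Us" for U
    proof -
      have "0 \<le> diameter U" "diameter U \<le> \<delta>"
        using Us(2) that by (auto intro: diameter_ge_0)
      then have "diameter U powr s' = diameter U powr (s' - s) * diameter U powr s"
        "diameter U powr (s' - s) \<le> \<delta> powr (s' - s)"
        using assms by (auto simp: powr_add[symmetric] intro: powr_mono2)
      then show ?thesis
        using assms by (auto simp: diam_powr_def intro: mult_right_mono)
    qed
    then have "(\<Sum>i<length Us. diam_powr s' (V i)) \<le> (\<Sum>i<length Us. \<delta> powr (s' - s) * diam_powr s (Us ! i))"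
      by (intro sum_mono) (auto simp: V_def)
    also have "\<dots> = \<delta> powr (s' - s) * (\<Sum>U\<leftarrow>Us. diam_powr s U)"
      by (simp add: sum_distrib_left sum_list_sum_nth atLeast0LessThan)
    also have "\<dots> \<le> \<delta> powr (s' - s) * c"
      using Us(3) by (rule mult_left_mono) simp
    finally show "(\<Sum>i<length Us. diam_powr s' (V i)) \<le> \<delta> powr (s' - s) * c" .
  qed
  finally show ?thesis .
qed

text \<open>The cost at exponent \<open>s\<close> stays below \<open>c\<close> while the scales
  shrink, so the extra factor \<open>\<delta> k powr (s' - s)\<close> drives the premeasure to
  \<open>0\<close>.\<close>

lemma hausdorff_measure_eq_0_if_has_cover:
  assumes cover: "\<And>k. has_cover s (\<delta> k) c S" and \<delta>: "\<delta> \<longlonglongrightarrow> 0" "\<And>k. 0 \<le> \<delta> k"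
    and s: "0 < s" "s < s'"
  shows "hausdorff_measure s' S = 0"
proof -
  have "hausdorff_premeasure s' \<epsilon> S \<le> 0" if "0 < \<epsilon>" for \<epsilon>
  proof (rule tendsto_lowerbound)
    have "(\<lambda>k. \<delta> k powr (s' - s) * c) \<longlonglongrightarrow> 0 * c"
      using \<delta> s by (intro tendsto_mult tendsto_const tendsto_zero_powrI[OF _ tendsto_const]) auto
    then show "(\<lambda>k. ennreal (\<delta> k powr (s' - s) * c)) \<longlonglongrightarrow> 0"
      using tendsto_ennrealI by fastforce
    show "\<forall>\<^sub>F k in sequentially. hausdorff_premeasure s' \<epsilon> S \<le> ennreal (\<delta> k powr (s' - s) * c)"
      using order_tendstoD(2)[OF \<delta>(1) that]
      by eventually_elim (use \<delta>(2) s cover in \<open>auto intro: hausdorff_premeasure_le_if_has_cover\<close>)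
  qed simp
  then show ?thesis
    unfolding hausdorff_measure_def by (auto intro!: antisym SUP_least)
qed

lemma hausdorff_dim_le_if_has_cover:
  assumes "\<And>k. has_cover s (\<delta> k) c S" "\<delta> \<longlonglongrightarrow> 0" "\<And>k. 0 \<le> \<delta> k" "0 < s"
  shows "hausdorff_dim S \<le> ereal s"
proof (rule ereal_le_epsilon2)
  fix e :: real assume "0 < e"
  then have "hausdorff_measure (s + e) S = 0"
    using assms by (intro hausdorff_measure_eq_0_if_has_cover[of s \<delta> c]) auto
  then show "hausdorff_dim S \<le> ereal s + ereal e"
    unfolding hausdorff_dim_def using assms(4) \<open>0 < e\<close>
    by (intro INF_lower2[of "s + e"]) auto
qed

text \<open>The segment is cut into \<open>m\<close> pieces of length at most \<open>H\<close>; with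
  the thickening each has diameter at most \<open>3 * H\<close>. Since
  \<open>H \<le> norm b\<close>, rounding up still gives
  \<open>m \<le> 3 * norm b / H\<close>.\<close>

lemma has_cover_strip:
  fixes v b :: "'a::real_inner"
  assumes H: "0 < H" "H \<le> norm b" and s: "0 < s"
  shows "has_cover s (3 * H) (3 * 3 powr s * norm b * H powr (s - 1))
    {v + t *\<^sub>R b + z | t z. -1 \<le> t \<and> t \<le> 1 \<and> norm z \<le> H}"
proof -
  define a where "a = norm b"
  define m where "m = nat \<lceil>2 * a / H\<rceil>"
  have a: "0 < a" "H \<le> a" using H by (auto simp: a_def)
  have m: "2 * a / H \<le> real m" "real m < 2 * a / H + 1"
    using a H by (auto simp: m_def) linarith+
  have m_pos: "0 < real m" using m(1) a H by (smt (verit) divide_pos_pos)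
  have m_le: "real m \<le> 3 * a / H"
    using m(2) a H by (simp add: field_simps)
  define U where "U i = {v + t *\<^sub>R b + z | t z. -1 + 2 * real i / m \<le> t \<and> t \<le> -1 + 2 * real (Suc i) / m \<and> norm z \<le> H}"
    for i :: nat
  have dist_U: "norm (x - y) \<le> 3 * H" if xy: "x \<in> U i" "y \<in> U i" for i x y
  proof -
    obtain t z where x: "x = v + t *\<^sub>R b + z" "norm z \<le> H"
      "-1 + 2 * real i / m \<le> t" "t \<le> -1 + 2 * real (Suc i) / m"
      using xy(1) unfolding U_def by blast
    obtain t' z' where y: "y = v + t' *\<^sub>R b + z'" "norm z' \<le> H"
      "-1 + 2 * real i / m \<le> t'" "t' \<le> -1 + 2 * real (Suc i) / m"
      using xy(2) unfolding U_def by blast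
    have "\<bar>t - t'\<bar> \<le> 2 * real (Suc i) / m - 2 * real i / m"
      using x(3,4) y(3,4) by linarith
    also have "\<dots> = 2 / m" by (simp add: diff_divide_distrib[symmetric])
    finally have "\<bar>t - t'\<bar> * a \<le> 2 / m * a" using a by (intro mult_right_mono) auto
    also have "\<dots> \<le> H" using m(1) m_pos H by (simp add: field_simps)
    finally have tH: "\<bar>t - t'\<bar> * a \<le> H" .
    have "x - y = (t - t') *\<^sub>R b + (z - z')"
      by (simp add: x(1) y(1) algebra_simps)
    moreover have "norm ((t - t') *\<^sub>R b + (z - z')) \<le> \<bar>t - t'\<bar> * a + (norm z + norm z')"
      unfolding a_def by (intro order_trans[OF norm_triangle_ineq] add_mono norm_triangle_ineq4) simp
    ultimately have "norm (x - y) \<le> \<bar>t - t'\<bar> * a + (norm z + norm z')" by simp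
    then show ?thesis using tH x(2) y(2) by linarith
  qed
  have bounded_U: "bounded (U i)" for i
  proof (cases "U i = {}")
    case False
    then obtain y where "y \<in> U i" by auto
    then show ?thesis
      unfolding bounded_def dist_norm using dist_U by blast
  qed simp
  have diam_U: "diameter (U i) \<le> 3 * H" for i
    using dist_U[of _ i] H by (intro diameter_le) auto
  have "diam_powr s (U i) \<le> (3 * H) powr s" for i
    using diam_U[of i] diameter_ge_0[OF bounded_U[of i]] s by (auto simp: diam_powr_def intro: powr_mono2)
  then have "(\<Sum>U\<leftarrow>map U [0..<m]. diam_powr s U) \<le> real m * (3 * H) powr s"
    using sum_list_mono[of "[0..<m]" "\<lambda>i. diam_powr s (U i)" "\<lambda>i. (3 * H) powr s"]
    by (simp add: o_def sum_list_triv)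
  also have "\<dots> \<le> 3 * a / H * (3 * H) powr s"
    using m_le by (intro mult_right_mono) auto
  also have "\<dots> = 3 * 3 powr s * a * H powr (s - 1)"
    using H by (simp add: powr_mult powr_diff)
  finally have cost: "(\<Sum>U\<leftarrow>map U [0..<m]. diam_powr s U) \<le> 3 * 3 powr s * a * H powr (s - 1)" .
  have "{v + t *\<^sub>R b + z | t z. -1 \<le> t \<and> t \<le> 1 \<and> norm z \<le> H} \<subseteq> \<Union>(set (map U [0..<m]))"
  proof safe
    fix t :: real and z :: 'a assume tz: "-1 \<le> t" "t \<le> 1" "norm z \<le> H"
    \<comment> \<open>The minimum catches the endpoint \<open>t = 1\<close>, where the floor equals
      \<open>m\<close>.\<close>
    define i where "i = min (m - 1) (nat \<lfloor>(t + 1) * m / 2\<rfloor>)"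
    have "i < m" using m_pos by (auto simp: i_def)
    have nonneg: "0 \<le> (t + 1) * m / 2" using tz by simp
    have "real i \<le> (t + 1) * m / 2" using nonneg unfolding i_def by (smt (verit) min.cobounded2 of_nat_mono of_nat_floor)
    moreover have "(t + 1) * m / 2 \<le> real (Suc i)"
    proof (cases "nat \<lfloor>(t + 1) * m / 2\<rfloor> \<le> m - 1")
      case True
      then show ?thesis unfolding i_def by simp linarith
    next
      case False
      then have "real (Suc i) = m" using m_pos by (simp add: i_def)
      moreover have "(t + 1) * real m \<le> 2 * real m" using tz by (intro mult_right_mono) auto
      ultimately show ?thesis by simp
    qed
    ultimately have "-1 + 2 * real i / m \<le> t" "t \<le> -1 + 2 * real (Suc i) / m"
      using m_pos by (simp_all add: field_simps)
    then have "v + t *\<^sub>R b + z \<in> U i" using tz unfolding U_def by blast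
    then show "v + t *\<^sub>R b + z \<in> \<Union>(set (map U [0..<m]))" using \<open>i < m\<close> by auto
  qed
  then show ?thesis
    unfolding has_cover_def using cost bounded_U diam_U
    by (intro exI[of _ "map U [0..<m]"]) (auto simp: a_def)
qed

section \<open>Triangles spanned by the columns\<close>

text \<open>The squared area of the parallelogram spanned by \<open>b\<close> and
  \<open>c\<close>.\<close>

definition gram :: "'a::real_inner \<Rightarrow> 'a \<Rightarrow> real" where
  "gram b c = (b \<bullet> b) * (c \<bullet> c) - (b \<bullet> c)^2"

text \<open>Let \<open>a\<close> be the length of \<open>p q\<close> and \<open>H = g / a\<close>
  the height over it. As \<open>p r\<close> is no longer, \<open>r\<close> projects to a parameter
  in \<open>[-1, 1]\<close>, so the triangle lies in a strip. Its cost is a multiple of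
  \<open>a * H powr (s - 1) = a powr (2 - s) * g powr (s - 1)\<close>, which is nondecreasing in
  \<open>a\<close> because \<open>s \<le> 2\<close>.\<close>

lemma has_cover_triangle_long_edge:
  fixes p q r :: "'a::real_inner"
  assumes gram: "0 < gram (q - p) (r - p)" and long: "dist p r \<le> dist p q" and A: "dist p q \<le> A"
    and s: "1 \<le> s" "s \<le> 2"
  shows "has_cover s (3 * A) (3 * 3 powr s * A powr (2 - s) * sqrt (gram (q - p) (r - p)) powr (s - 1))
    (convex hull {p, q, r})"
proof -
  define b c g where "b = q - p" and "c = r - p" and "g = sqrt (gram b c)"
  define a where "a = norm b"
  have g: "0 < g" "g^2 = gram b c" using gram by (auto simp: g_def b_def c_def)
  have ca: "norm c \<le> a" and aA: "a \<le> A"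
    using long A by (auto simp: a_def b_def c_def dist_norm norm_minus_commute)
  have "b \<noteq> 0" using g by (auto simp: gram_def)
  then have a: "0 < a" by (simp add: a_def)
  have bb: "b \<bullet> b = a^2" by (simp add: a_def power2_norm_eq_inner)
  define l where "l = (b \<bullet> c) / a^2"
  define H where "H = g / a"
  have l: "\<bar>l\<bar> \<le> 1"
  proof -
    have "\<bar>b \<bullet> c\<bar> \<le> a * norm c" unfolding a_def by (rule Cauchy_Schwarz_ineq2)
    also have "\<dots> \<le> a * a" using ca a by (intro mult_left_mono) auto
    finally show ?thesis using a by (simp add: l_def power2_eq_square)
  qed
  have "(norm (c - l *\<^sub>R b))^2 = c \<bullet> c - 2 * l * (b \<bullet> c) + l^2 * a^2"
    unfolding power2_norm_eq_inner
    by (simp add: inner_diff_left inner_diff_right inner_commute bb power2_eq_square algebra_simps)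
  also have "\<dots> = H^2"
    unfolding H_def l_def power_divide g(2) gram_def bb using a
    by (simp add: field_simps power2_eq_square)
  finally have height: "norm (c - l *\<^sub>R b) = H"
    using a g by (simp add: H_def power2_eq_iff_nonneg)
  have H: "0 < H" using a g by (simp add: H_def)
  \<comment> \<open>The area is at most the product of the two edge lengths; this gives
    \<open>H \<le> a\<close>, as the strip bound requires.\<close>
  have "g \<le> a * a"
  proof (rule power2_le_imp_le)
    have "c \<bullet> c \<le> a^2" using ca by (simp add: power2_norm_eq_inner[symmetric] power_mono)
    then have "a^2 * (c \<bullet> c) \<le> a^2 * a^2" by (intro mult_left_mono) auto
    then show "g^2 \<le> (a * a)^2"
      unfolding g(2) gram_def bb power_mult_distrib using zero_le_power2[of "b \<bullet> c"] by linarith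
  qed (use a in auto)
  then have "H \<le> a" using a by (simp add: H_def field_simps)
  note strip = has_cover_strip[OF H, of b s p]
  show ?thesis
  proof (rule has_cover_mono[OF strip])
    show "H \<le> norm b" "0 < s" using \<open>H \<le> a\<close> s by (auto simp: a_def)
    show "3 * H \<le> 3 * A" using \<open>H \<le> a\<close> aA by simp
    have "a * H powr (s - 1) = a powr (2 - s) * g powr (s - 1)"
    proof -
      have "a * H powr (s - 1) = a powr 1 * (g powr (s - 1) / a powr (s - 1))"
        using a g by (simp add: H_def powr_divide)
      also have "\<dots> = a powr (1 - (s - 1)) * g powr (s - 1)" by (subst powr_diff) simp
      finally show ?thesis by simp
    qed
    also have "\<dots> \<le> A powr (2 - s) * g powr (s - 1)"
      using a aA s by (intro mult_right_mono powr_mono2) auto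
    finally show "3 * 3 powr s * norm b * H powr (s - 1)
        \<le> 3 * 3 powr s * A powr (2 - s) * sqrt (gram (q - p) (r - p)) powr (s - 1)"
      unfolding a_def[symmetric] b_def[symmetric] c_def[symmetric] g_def[symmetric]
      by (simp add: mult.assoc)
    show "convex hull {p, q, r} \<subseteq> {p + t *\<^sub>R b + z |t z. - 1 \<le> t \<and> t \<le> 1 \<and> norm z \<le> H}"
    proof
      fix x assume "x \<in> convex hull {p, q, r}"
      then obtain u v where uv: "x = p + u *\<^sub>R b + v *\<^sub>R c" "0 \<le> u" "0 \<le> v" "u + v \<le> 1"
        unfolding convex_hull_3_alt b_def c_def by auto
      have "\<bar>u + v * l\<bar> \<le> u + v * \<bar>l\<bar>" using uv by (simp add: abs_mult order_trans[OF abs_triangle_ineq])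
      also have "\<dots> \<le> u + v * 1" using l uv by (intro add_left_mono mult_left_mono) auto
      finally have "\<bar>u + v * l\<bar> \<le> 1" using uv by linarith
      moreover have "norm (v *\<^sub>R (c - l *\<^sub>R b)) \<le> H"
        using uv height H by (simp add: mult_left_le_one_le)
      moreover have "x = p + (u + v * l) *\<^sub>R b + v *\<^sub>R (c - l *\<^sub>R b)"
        by (simp add: uv(1) algebra_simps)
      ultimately show "x \<in> {p + t *\<^sub>R b + z |t z. - 1 \<le> t \<and> t \<le> 1 \<and> norm z \<le> H}"
        unfolding abs_le_iff mem_Collect_eq
        by (intro exI[of _ "u + v * l"] exI[of _ "v *\<^sub>R (c - l *\<^sub>R b)"]) auto
    qed
  qed
qed

text \<open>The Gram determinant is invariant under rotating the vertices, and the three edge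
  comparisons cannot all fail, since their negations form a cycle.\<close>

lemma has_cover_triangle:
  fixes p q r :: "'a::real_inner"
  assumes gram: "0 < gram (q - p) (r - p)" and A: "dist p q \<le> A" "dist q r \<le> A" "dist r p \<le> A"
    and s: "1 \<le> s" "s \<le> 2"
  shows "has_cover s (3 * A) (3 * 3 powr s * A powr (2 - s) * sqrt (gram (q - p) (r - p)) powr (s - 1))
    (convex hull {p, q, r})"
proof -
  have rot: "gram (r - q) (p - q) = gram (q - p) (r - p)" "gram (p - r) (q - r) = gram (q - p) (r - p)"
    unfolding gram_def by (simp_all add: inner_diff_left inner_diff_right inner_commute power2_eq_square algebra_simps)
  consider "dist r p \<le> dist p q" | "dist p q \<le> dist q r" | "dist q r \<le> dist r p" by linarith
  then show ?thesis
  proof cases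
    case 1
    then show ?thesis
      using has_cover_triangle_long_edge[of q p r A s] gram A s by (simp add: dist_commute)
  next
    case 2
    then show ?thesis
      using has_cover_triangle_long_edge[of r q p A s] gram A s
      by (simp add: rot dist_commute insert_commute)
  next
    case 3
    then show ?thesis
      using has_cover_triangle_long_edge[of p r q A s] gram A s
      by (simp add: rot dist_commute insert_commute)
  qed
qed

section \<open>Frames and their edge lengths\<close>

definition mass :: "real^3 \<Rightarrow> real" where
  "mass x = x$1 + x$2 + x$3"

lemma mass_add [simp]: "mass (x + y) = mass x + mass y"
  and mass_scaleR [simp]: "mass (t *\<^sub>R x) = t * mass x"
  by (simp_all add: mass_def algebra_simps)

definition triple_det :: "real^3 \<Rightarrow> real^3 \<Rightarrow> real^3 \<Rightarrow> real" where
  "triple_det a b c = a$1 * (b$2 * c$3 - b$3 * c$2) - a$2 * (b$1 * c$3 - b$3 * c$1)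
     + a$3 * (b$1 * c$2 - b$2 * c$1)"

text \<open>The cross product of \<open>q - p\<close> and \<open>r - p\<close> is normal to the
  plane of mass \<open>1\<close>, hence a multiple of \<open>(1, 1, 1)\<close>; pairing it with
  \<open>p\<close> shows that the multiple is the determinant.\<close>

lemma gram_eq_triple_det:
  assumes "mass p = 1" "mass q = 1" "mass r = 1"
  shows "gram (q - p) (r - p) = 3 * (triple_det p q r)^2"
proof -
  have *: "p$3 = 1 - p$1 - p$2" "q$3 = 1 - q$1 - q$2" "r$3 = 1 - r$1 - r$2"
    using assms by (auto simp: mass_def)
  show ?thesis
    unfolding gram_def triple_det_def inner_vec_def sum_3 vector_minus_component inner_real_def *
    by algebra
qed

text \<open>The columns of the matrix of a word in the three maps, with the estimate
  \<open>dist (a / mass a) (b / mass b) \<le> 2 / max (mass a) (mass b)\<close> in denominator-free form.\<close>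

definition frame :: "real^3 \<Rightarrow> real^3 \<Rightarrow> real^3 \<Rightarrow> bool" where
  "frame a b c \<longleftrightarrow>
     1 \<le> mass a \<and> 1 \<le> mass b \<and> 1 \<le> mass c \<and>
     mass a \<le> mass b + mass c \<and> mass b \<le> mass c + mass a \<and> mass c \<le> mass a + mass b \<and>
     (triple_det a b c)^2 = 1 \<and>
     norm (mass b *\<^sub>R a - mass a *\<^sub>R b) \<le> 2 * min (mass a) (mass b) \<and>
     norm (mass c *\<^sub>R b - mass b *\<^sub>R c) \<le> 2 * min (mass b) (mass c) \<and>
     norm (mass a *\<^sub>R c - mass c *\<^sub>R a) \<le> 2 * min (mass c) (mass a)"

text \<open>Cyclic symmetry reduces all three letters to the first.\<close>

lemma frame_rotate: "frame a b c \<Longrightarrow> frame b c a"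
proof -
  have "triple_det b c a = triple_det a b c" by (simp add: triple_det_def algebra_simps)
  then show "frame a b c \<Longrightarrow> frame b c a" by (simp add: frame_def)
qed

text \<open>Eliminating \<open>u\<close> gives \<open>v\<close> and \<open>w\<close> the nonnegative
  coefficients \<open>z + x\<close> and \<open>z - y\<close>, and
  \<open>(z + x) * y + (z - y) * x = z * (x + y)\<close>. A plain triangle inequality would add a
  term for \<open>u\<close>.\<close>

lemma edge_bound:
  fixes u v w :: "'a::real_normed_vector"
  assumes pos: "0 < x" "0 < y" "0 < z" and rel: "z *\<^sub>R u + x *\<^sub>R v = y *\<^sub>R w" and "y \<le> z"
    and bound: "norm v \<le> C * y" "norm w \<le> C * x" "0 \<le> C"
  shows "norm (v + w - u) \<le> C * (x + y)"
proof -
  have "z *\<^sub>R (v + w - u) = (z + x) *\<^sub>R v + (z - y) *\<^sub>R w"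
    using rel by (simp add: algebra_simps)
  then have "z * norm (v + w - u) = norm ((z + x) *\<^sub>R v + (z - y) *\<^sub>R w)"
    using pos by (metis norm_scaleR abs_of_pos)
  also have "\<dots> \<le> (z + x) * norm v + (z - y) * norm w"
    using assms by (intro order_trans[OF norm_triangle_ineq]) simp
  also have "\<dots> \<le> (z + x) * (C * y) + (z - y) * (C * x)"
    using assms by (intro add_mono mult_left_mono) auto
  also have "\<dots> = z * (C * (x + y))" by (simp add: algebra_simps)
  finally show ?thesis using pos by simp
qed

text \<open>Column operations preserve the determinant, and the two edges at \<open>a\<close> keep
  their cross-multiplied vectors up to sign. Only the opposite edge changes;
  \<open>edge_bound\<close> handles it, with \<open>b\<close> and \<open>c\<close> exchanged if
  \<open>z < y\<close>.\<close>

lemma frame_child: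
  assumes "frame a b c"
  shows "frame a (a + b) (a + c)"
proof -
  define x y z where "x = mass a" and "y = mass b" and "z = mass c"
  define u v w where "u = y *\<^sub>R a - x *\<^sub>R b" and "v = z *\<^sub>R b - y *\<^sub>R c" and "w = z *\<^sub>R a - x *\<^sub>R c"
  have F: "1 \<le> x" "1 \<le> y" "1 \<le> z" "x \<le> y + z" "y \<le> z + x" "z \<le> x + y" "(triple_det a b c)^2 = 1"
    "norm u \<le> 2 * min x y" "norm v \<le> 2 * min y z" "norm w \<le> 2 * min x z"
    using assms unfolding frame_def u_def v_def w_def x_def y_def z_def
    by (auto simp: norm_minus_commute min.commute)
  have det: "triple_det a (a + b) (a + c) = triple_det a b c"
    by (simp add: triple_det_def algebra_simps)
  have edges: "(x + y) *\<^sub>R a - x *\<^sub>R (a + b) = u"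
    "(x + z) *\<^sub>R (a + b) - (x + y) *\<^sub>R (a + c) = v + w - u"
    "x *\<^sub>R (a + c) - (x + z) *\<^sub>R a = - w"
    unfolding u_def v_def w_def by (simp_all add: algebra_simps)
  have "norm (v + w - u) \<le> 2 * (x + min y z)"
  proof (cases "y \<le> z")
    case True
    have "norm (v + w - u) \<le> 2 * (x + y)"
      using F True by (intro edge_bound[of x y z]) (auto simp: u_def v_def w_def algebra_simps)
    then show ?thesis using True by simp
  next
    case False
    have "norm (- v + u - w) \<le> 2 * (x + z)"
      using F False by (intro edge_bound[of x z y])
        (auto simp: u_def v_def w_def norm_minus_commute algebra_simps)
    moreover have "- v + u - w = - (v + w - u)" by simp
    ultimately have "norm (v + w - u) \<le> 2 * (x + z)" by (metis norm_minus_cancel)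
    then show ?thesis using False by simp
  qed
  then show ?thesis
    using F unfolding frame_def det mass_add x_def[symmetric] y_def[symmetric] z_def[symmetric]
      edges norm_minus_cancel
    by (auto simp: min_add_distrib_right)
qed

section \<open>Self-similarity of the gasket\<close>

lemma rauzy_map_nth: "rauzy_map j x $ i = (if i = j then 1 else x$i) / (2 - x$j)"
  by (simp add: rauzy_map_def)

lemma std_simplex_nth_bounds:
  assumes "x \<in> std_simplex"
  shows "0 \<le> x$j" "x$j \<le> 1"
  using assms exhaust_3[of j] by (auto simp: std_simplex_def)

lemma axis_in_std_simplex: "axis j 1 \<in> std_simplex"
  using exhaust_3[of j] by (auto simp: std_simplex_def axis_def)

lemma std_simplex_eq_axis:
  assumes "x \<in> std_simplex" "x$j = 1"
  shows "x = axis j 1"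
  using assms exhaust_3[of j] by (auto simp: std_simplex_def axis_def vec_eq_iff forall_3)

lemma closed_std_simplex: "closed std_simplex"
proof -
  have *: "std_simplex = {x::real^3. 0 \<le> x$1} \<inter> {x. 0 \<le> x$2} \<inter> {x. 0 \<le> x$3} \<inter> {x. x$1 + x$2 + x$3 = 1}"
    by (auto simp: std_simplex_def)
  show ?thesis
    unfolding * by (intro closed_Int closed_Collect_le closed_Collect_eq continuous_intros)
qed

lemma compact_std_simplex: "compact std_simplex"
proof -
  have "norm x \<le> 1" if "x \<in> std_simplex" for x
    using that norm_le_l1_cart[of x] by (simp add: std_simplex_def sum_3)
  then have "bounded std_simplex" by (auto simp: bounded_iff)
  then show ?thesis using closed_std_simplex by (simp add: compact_eq_bounded_closed)
qed

lemma rauzy_map_in_std_simplex: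
  assumes "x \<in> std_simplex"
  shows "rauzy_map j x \<in> std_simplex"
proof -
  have "0 < 2 - x$j" using std_simplex_nth_bounds[OF assms, of j] by simp
  then show ?thesis
    using assms exhaust_3[of j]
    by (auto simp: std_simplex_def rauzy_map_nth add_divide_distrib[symmetric])
qed

lemma continuous_on_rauzy_map: "continuous_on std_simplex (rauzy_map j)"
proof -
  have "2 - x$j \<noteq> 0" if "x \<in> std_simplex" for x :: "real^3"
    using std_simplex_nth_bounds[OF that, of j] by simp
  moreover have "continuous_on std_simplex (\<lambda>x. if i = j then 1 else x$i)" for i
    by (cases "i = j") (auto intro!: continuous_intros)
  ultimately show ?thesis
    unfolding rauzy_map_def by (intro continuous_on_vec_lambda continuous_intros) auto
qed

section \<open>The gasket as an orbit closure\<close>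

lemma rauzy_map_axis: "rauzy_map j (axis j 1) = axis j 1"
  by (simp add: vec_eq_iff rauzy_map_nth axis_def)

inductive_set vertex_orbit :: "(real^3) set" where
  vertex: "axis j 1 \<in> vertex_orbit"
| step: "x \<in> vertex_orbit \<Longrightarrow> rauzy_map j x \<in> vertex_orbit"

lemma vertex_orbit_subset: "vertex_orbit \<subseteq> std_simplex"
proof
  fix x assume "x \<in> vertex_orbit"
  then show "x \<in> std_simplex"
    by induction (auto intro: axis_in_std_simplex rauzy_map_in_std_simplex)
qed

text \<open>The point of an invariant compact set that maximises the \<open>j\<close>-th coordinate is the \<open>j\<close>-th vertex,
  because \<open>1 / (2 - t) > t\<close> for \<open>t < 1\<close>.\<close>

lemma axis_in_invariant_set:
  assumes "G \<noteq> {}" "closed G" "G \<subseteq> std_simplex" "rauzy_map j ` G \<subseteq> G"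
  shows "axis j 1 \<in> G"
proof -
  have "compact G"
    using compact_std_simplex assms by (metis compact_Int_closed inf.absorb_iff2)
  moreover have "continuous_on G (\<lambda>x. x$j)" by (intro continuous_intros)
  ultimately obtain x where x: "x \<in> G" "\<And>y. y \<in> G \<Longrightarrow> y$j \<le> x$j"
    using continuous_attains_sup assms(1) by metis
  have bounds: "0 \<le> x$j" "x$j \<le> 1"
    using std_simplex_nth_bounds[of x j] x(1) assms(3) by auto
  have "rauzy_map j x $ j \<le> x$j" using x assms(4) by blast
  then have "1 \<le> x$j * (2 - x$j)" using bounds by (simp add: rauzy_map_nth divide_le_eq)
  then have "(1 - x$j)^2 \<le> 0" by (simp add: power2_eq_square algebra_simps)
  then have "x$j = 1" by simp
  then show ?thesis using std_simplex_eq_axis x(1) assms(3) by blast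
qed

text \<open>The closure \<open>?K\<close> of the orbit satisfies the equation because the images of
  a compact set have a closed union; it lies in every competitor \<open>G\<close> because
  \<open>G\<close> contains the vertices and is invariant.\<close>

lemma rauzy_gasket_subset: "rauzy_gasket \<subseteq> std_simplex"
  and rauzy_gasket_invariant: "rauzy_gasket = (\<Union>j\<in>UNIV. rauzy_map j ` rauzy_gasket)"
proof -
  let ?K = "closure vertex_orbit"
  have sub: "?K \<subseteq> std_simplex"
    using vertex_orbit_subset closed_std_simplex by (rule closure_minimal)
  have cont: "continuous_on ?K (rauzy_map j)" for j
    using continuous_on_rauzy_map sub by (rule continuous_on_subset)
  have "compact ?K"
    using compact_std_simplex sub by (metis closed_closure compact_Int_closed inf.absorb_iff2)
  then have "closed (\<Union>j\<in>UNIV. rauzy_map j ` ?K)"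
    using cont by (intro compact_imp_closed compact_UN compact_continuous_image) auto
  moreover have "vertex_orbit \<subseteq> (\<Union>j\<in>UNIV. rauzy_map j ` ?K)"
  proof
    fix x assume "x \<in> vertex_orbit"
    then show "x \<in> (\<Union>j\<in>UNIV. rauzy_map j ` ?K)"
    proof cases
      case (vertex j)
      then have "x = rauzy_map j (axis j 1)" by (simp add: rauzy_map_axis)
      moreover have "axis j 1 \<in> ?K" using vertex_orbit.vertex closure_subset by blast
      ultimately show ?thesis by blast
    next
      case (step y j)
      then show ?thesis using closure_subset by blast
    qed
  qed
  ultimately have "?K \<subseteq> (\<Union>j\<in>UNIV. rauzy_map j ` ?K)" by (rule closure_minimal[rotated])
  moreover have "rauzy_map j ` ?K \<subseteq> ?K" for j
    using cont closure_subset[of vertex_orbit] by (intro image_closure_subset) (auto intro: vertex_orbit.step)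
  moreover have "?K \<noteq> {}" using vertex_orbit.vertex by auto
  ultimately have K: "?K \<noteq> {} \<and> closed ?K \<and> ?K \<subseteq> std_simplex \<and> ?K = (\<Union>j\<in>UNIV. rauzy_map j ` ?K)"
    using sub by auto
  have "rauzy_gasket = ?K"
    unfolding rauzy_gasket_def
  proof (rule Least_equality, rule K)
    fix G :: "(real^3) set"
    assume G: "G \<noteq> {} \<and> closed G \<and> G \<subseteq> std_simplex \<and> G = (\<Union>j\<in>UNIV. rauzy_map j ` G)"
    then have inv: "rauzy_map j ` G \<subseteq> G" for j by blast
    have "vertex_orbit \<subseteq> G"
    proof
      fix x assume "x \<in> vertex_orbit"
      then show "x \<in> G" by induction (use G inv axis_in_invariant_set in auto)
    qed
    then show "?K \<subseteq> G" using G by (intro closure_minimal) auto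
  qed
  then show "rauzy_gasket \<subseteq> std_simplex"
    and "rauzy_gasket = (\<Union>j\<in>UNIV. rauzy_map j ` rauzy_gasket)"
    using K by auto
qed

section \<open>Covering the cylinder sets\<close>

text \<open>The projective action of the matrix with columns \<open>a, b, c\<close>; the denominator
  is the mass of the numerator.\<close>

definition blend :: "real^3 \<Rightarrow> real^3 \<Rightarrow> real^3 \<Rightarrow> real^3 \<Rightarrow> real^3" where
  "blend a b c x = (x$1 *\<^sub>R a + x$2 *\<^sub>R b + x$3 *\<^sub>R c) /\<^sub>R (x$1 * mass a + x$2 * mass b + x$3 * mass c)"

lemma blend_scaleR: "t \<noteq> 0 \<Longrightarrow> blend a b c (t *\<^sub>R x) = blend a b c x"
proof -
  assume "t \<noteq> 0"
  have "blend a b c (t *\<^sub>R x)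
      = (t *\<^sub>R (x$1 *\<^sub>R a + x$2 *\<^sub>R b + x$3 *\<^sub>R c)) /\<^sub>R (t * (x$1 * mass a + x$2 * mass b + x$3 * mass c))"
    by (simp add: blend_def algebra_simps)
  then show ?thesis using \<open>t \<noteq> 0\<close> by (simp add: blend_def)
qed

lemma blend_rauzy_map:
  assumes "x \<in> std_simplex"
  shows "blend a b c (rauzy_map 1 x) = blend a (a + b) (a + c) x"
    and "blend a b c (rauzy_map 2 x) = blend (a + b) b (b + c) x"
    and "blend a b c (rauzy_map 3 x) = blend (a + c) (b + c) c x"
proof -
  have pos: "0 < 2 - x$j" for j using std_simplex_nth_bounds[OF assms, of j] by simp
  have clear: "blend a b c (rauzy_map j x) = blend a b c ((2 - x$j) *\<^sub>R rauzy_map j x)" for j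
    using blend_scaleR[of "2 - x$j"] pos[of j] by simp
  \<comment> \<open>Writing the numerator \<open>1\<close> as the coordinate sum makes the map
    linear, so composing with it adds column \<open>j\<close> to the others.\<close>
  have nth: "((2 - x$j) *\<^sub>R rauzy_map j x) $ i = (if i = j then x$1 + x$2 + x$3 else x$i)" for i j
    using assms pos[of j] by (auto simp: rauzy_map_nth std_simplex_def)
  show "blend a b c (rauzy_map 1 x) = blend a (a + b) (a + c) x"
    "blend a b c (rauzy_map 2 x) = blend (a + b) b (b + c) x"
    "blend a b c (rauzy_map 3 x) = blend (a + c) (b + c) c x"
    unfolding clear unfolding blend_def nth by (simp_all add: algebra_simps)
qed

lemma blend_image_subset:
  assumes "G \<subseteq> std_simplex" "G \<subseteq> (\<Union>j\<in>UNIV. rauzy_map j ` G)"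
  shows "blend a b c ` G \<subseteq>
    blend a (a + b) (a + c) ` G \<union> blend (a + b) b (b + c) ` G \<union> blend (a + c) (b + c) c ` G"
proof
  fix v assume "v \<in> blend a b c ` G"
  then obtain j w where w: "w \<in> G" "v = blend a b c (rauzy_map j w)" using assms(2) by blast
  then have "w \<in> std_simplex" using assms(1) by blast
  then show "v \<in> blend a (a + b) (a + c) ` G \<union> blend (a + b) b (b + c) ` G \<union> blend (a + c) (b + c) c ` G"
    using blend_rauzy_map[of w a b c] w exhaust_3[of j] by auto
qed

lemma blend_in_convex_hull:
  assumes "x \<in> std_simplex" "0 < mass a" "0 < mass b" "0 < mass c"
  shows "blend a b c x \<in> convex hull {a /\<^sub>R mass a, b /\<^sub>R mass b, c /\<^sub>R mass c}"
proof -
  define d where "d = x$1 * mass a + x$2 * mass b + x$3 * mass c"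
  have x: "0 \<le> x$1" "0 \<le> x$2" "0 \<le> x$3" "x$1 + x$2 + x$3 = 1"
    using assms by (auto simp: std_simplex_def)
  have "0 \<le> x$1 * mass a" "0 \<le> x$2 * mass b" "0 \<le> x$3 * mass c" using x assms by auto
  moreover have "x$1 \<noteq> 0 \<or> x$2 \<noteq> 0 \<or> x$3 \<noteq> 0" using x by auto
  ultimately have d: "0 < d" unfolding d_def using assms x
    by (metis add_nonneg_pos add_pos_nonneg add_nonneg_nonneg mult_pos_pos order_le_less)
  have "x$1 * mass a / d + x$2 * mass b / d + x$3 * mass c / d = 1"
    using d by (simp add: d_def add_divide_distrib[symmetric])
  moreover have unscale: "(t * u / d) *\<^sub>R (v /\<^sub>R u) = (t / d) *\<^sub>R v" if "0 < u" for t u and v :: "real^3"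
    using that by simp
  then have "blend a b c x = (x$1 * mass a / d) *\<^sub>R (a /\<^sub>R mass a) + (x$2 * mass b / d) *\<^sub>R (b /\<^sub>R mass b)
      + (x$3 * mass c / d) *\<^sub>R (c /\<^sub>R mass c)"
    unfolding blend_def d_def[symmetric] unscale[OF assms(2)] unscale[OF assms(3)] unscale[OF assms(4)]
    by (simp add: scaleR_add_right divide_inverse_commute)
  ultimately show ?thesis
    unfolding convex_hull_3 using d x assms by (intro CollectI exI conjI) auto
qed

text \<open>The normalised columns of a frame lie at distance \<open>O(1 / s)\<close>, where \<open>s\<close> is the total mass, and
  span a triangle of area \<open>O(1 / (m * s\<^sup>2))\<close>, where \<open>m\<close> is the least column mass.\<close>

lemma frame_has_cover_base:
  fixes a b c :: "real^3"
  defines "s \<equiv> mass a + mass b + mass c" and "m \<equiv> min (mass a) (min (mass b) (mass c))"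
  assumes frame: "frame a b c" and m: "4 * m \<le> s" and G: "G \<subseteq> std_simplex"
  shows "has_cover 1.7415 (24 / s) (6 * 3 powr 1.7415 * 8 powr 0.2585 * 32 powr 0.7415 * potential s m)
    (blend a b c ` G)"
proof -
  define x y z where "x = mass a" and "y = mass b" and "z = mass c"
  have F: "1 \<le> x" "1 \<le> y" "1 \<le> z" "x \<le> y + z" "y \<le> z + x" "z \<le> x + y" "(triple_det a b c)^2 = 1"
    "norm (y *\<^sub>R a - x *\<^sub>R b) \<le> 2 * min x y" "norm (z *\<^sub>R b - y *\<^sub>R c) \<le> 2 * min y z"
    "norm (x *\<^sub>R c - z *\<^sub>R a) \<le> 2 * min z x"
    using frame unfolding frame_def x_def y_def z_def by auto
  have s: "s = x + y + z" "3 \<le> s" using F by (auto simp: s_def x_def y_def z_def)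
  have mm: "1 \<le> m" "m = min x (min y z)" using F by (auto simp: m_def x_def y_def z_def)
  define p q r where "p = a /\<^sub>R x" and "q = b /\<^sub>R y" and "r = c /\<^sub>R z"
  have mass: "mass p = 1" "mass q = 1" "mass r = 1"
    using F(1-3) unfolding p_def q_def r_def mass_scaleR by (simp_all flip: x_def y_def z_def)
  \<comment> \<open>By the triangle inequalities two masses make up at least half of
    \<open>s\<close>, so the larger is at least \<open>s / 4\<close>.\<close>
  have dist: "dist (u /\<^sub>R i) (v /\<^sub>R j) \<le> 8 / s"
    if "1 \<le> i" "1 \<le> j" "s \<le> 2 * (i + j)" "norm (j *\<^sub>R u - i *\<^sub>R v) \<le> 2 * min i j" for i j and u v :: "real^3"
  proof -
    have "u /\<^sub>R i - v /\<^sub>R j = (j *\<^sub>R u - i *\<^sub>R v) /\<^sub>R (i * j)"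
    proof -
      have "inverse (i * j) * j = inverse i" "inverse (i * j) * i = inverse j"
        using that(1,2) by (simp_all add: field_simps)
      then show ?thesis by (simp add: scaleR_diff_right del: inverse_mult_distrib)
    qed
    then have "dist (u /\<^sub>R i) (v /\<^sub>R j) = norm (j *\<^sub>R u - i *\<^sub>R v) / (i * j)"
      using that(1,2) by (simp add: dist_norm divide_inverse mult.commute)
    also have "\<dots> \<le> 2 * min i j / (i * j)"
      using that by (intro divide_right_mono) auto
    also have "\<dots> = 2 / max i j"
      using that(1,2) by (auto simp: min_def max_def)
    also have "\<dots> \<le> 2 / (s / 4)"
      using that(1,2,3) s by (intro divide_left_mono) auto
    finally show ?thesis by simp
  qed
  have d: "dist p q \<le> 8 / s" "dist q r \<le> 8 / s" "dist r p \<le> 8 / s"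
    unfolding p_def q_def r_def by (rule dist; use F s in simp)+
  have det: "triple_det p q r = triple_det a b c / (x * y * z)"
    unfolding triple_det_def p_def q_def r_def using F(1-3) by (simp add: field_simps)
  have gram: "gram (q - p) (r - p) = 3 / (x * y * z)^2"
    unfolding gram_eq_triple_det[OF mass] det using F(7) by (simp add: power_divide)
  have xyz: "0 < x * y * z" using F(1-3) by simp
  \<comment> \<open>Every mass is at most \<open>s / 2\<close> and the least is at most
    \<open>s / 4\<close>, so the other two are at least \<open>s / 4\<close>.\<close>
  have "m * (s / 4 * (s / 4)) \<le> x * y * z"
  proof -
    have prod: "m * (s / 4 * (s / 4)) \<le> i * (j * k)" if "m \<le> i" "s / 4 \<le> j" "s / 4 \<le> k" for i j k
      using that mm(1) s by (intro mult_mono) auto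
    consider "m = x" | "m = y" | "m = z" using mm(2) by linarith
    then show ?thesis
    proof cases
      case 1
      then show ?thesis using prod[of x y z] F m s by (simp add: mult_ac)
    next
      case 2
      then show ?thesis using prod[of y x z] F m s by (simp add: mult_ac)
    next
      case 3
      then show ?thesis using prod[of z x y] F m s by (simp add: mult_ac)
    qed
  qed
  then have vol: "m * s^2 / 16 \<le> x * y * z" by (simp add: power2_eq_square)
  have "sqrt (gram (q - p) (r - p)) = sqrt 3 / (x * y * z)"
    unfolding gram using xyz by (simp add: real_sqrt_divide)
  also have "\<dots> \<le> 2 / (m * s^2 / 16)"
    using vol xyz mm(1) s real_sqrt_le_mono[of 3 4] by (intro frac_le) auto
  finally have area: "sqrt (gram (q - p) (r - p)) \<le> 32 / (m * s^2)" by simp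
  define K where "K = 3 * 3 powr 1.7415 * 8 powr 0.2585 * (32::real) powr 0.7415"
  have K: "0 \<le> K" by (simp add: K_def)
  have "has_cover 1.7415 (3 * (8 / s)) (3 * 3 powr 1.7415 * (8 / s) powr (2 - 1.7415)
      * sqrt (gram (q - p) (r - p)) powr (1.7415 - 1)) (convex hull {p, q, r})"
    using d xyz by (intro has_cover_triangle) (auto simp: gram)
  then show ?thesis
  proof (rule has_cover_mono)
    show "blend a b c ` G \<subseteq> convex hull {p, q, r}"
      using blend_in_convex_hull[of _ a b c] G F(1-3) unfolding p_def q_def r_def x_def y_def z_def by auto
    show "3 * (8 / s) \<le> 24 / s" by simp
    have "3 * 3 powr 1.7415 * (8 / s) powr (2 - 1.7415) * sqrt (gram (q - p) (r - p)) powr (1.7415 - 1)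
        \<le> 3 * 3 powr 1.7415 * (8 / s) powr 0.2585 * (32 / (m * s^2)) powr 0.7415"
    proof -
      have e: "2 - 1.7415 = (0.2585::real)" "1.7415 - 1 = (0.7415::real)" by simp_all
      have "0 \<le> sqrt (gram (q - p) (r - p))" by (simp add: gram)
      then show ?thesis unfolding e using area by (intro mult_left_mono powr_mono2) auto
    qed
    also have "\<dots> = K * (s powr (- 1.7415) * m powr (- 0.7415))"
    proof -
      have "(8 / s) powr 0.2585 = 8 powr 0.2585 * s powr (-0.2585)"
        using s by (simp add: powr_divide powr_minus_divide)
      moreover have "(32 / (m * s^2)) powr 0.7415 = 32 powr 0.7415 * (m powr (-0.7415) * s powr (-1.483))"
      proof -
        have "(s^2) powr 0.7415 = s powr (2 * 0.7415)"
          using s powr_powr[of s 2 "0.7415"] by simp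
        then show ?thesis
          using s mm by (simp add: powr_divide powr_mult powr_minus_divide)
      qed
      moreover have "s powr (-0.2585) * s powr (-1.483) = s powr (-1.7415)"
        by (simp flip: powr_add)
      ultimately show ?thesis unfolding K_def by simp
    qed
    \<comment> \<open>Two losses: \<open>(m / s) powr 0.2585 \<le> 1\<close>, and
      \<open>s - 2 * m \<le> s\<close> in the denominator of \<open>potential\<close>.\<close>
    also have "\<dots> \<le> K * (2 * potential s m)"
    proof (rule mult_left_mono)
      have "s powr (- 1.7415) * m powr (- 0.7415)
          = s powr (- 1.483) * m powr (- 1) * (s powr (-0.2585) * m powr 0.2585)"
      proof -
        have "m powr (- 0.7415) = m powr (- 1) * m powr 0.2585"
          and "s powr (- 1.7415) = s powr (- 1.483) * s powr (- 0.2585)"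
          by (subst powr_add[symmetric], simp)+
        then show ?thesis by (simp only: mult_ac)
      qed
      also have "\<dots> \<le> s powr (- 1.483) * m powr (- 1) * 1"
      proof (intro mult_left_mono)
        have "s powr (-0.2585) * m powr 0.2585 \<le> s powr (-0.2585) * s powr 0.2585"
          using m mm s by (intro mult_left_mono powr_mono2) auto
        then show "s powr (-0.2585) * m powr 0.2585 \<le> 1" using s by (simp flip: powr_add)
      qed auto
      also have "\<dots> = s powr (- 2.483) * (s^2 / (m * s))"
      proof -
        have "s powr (- 1.483) = s powr (- 2.483) * s"
          using s(2) powr_add[of s "- 2.483" 1] by simp
        moreover have "m powr (- 1) = 1 / m" using mm(1) by (simp add: powr_minus_divide)
        moreover have "s^2 / (m * s) = s * (1 / m)" using s(2) mm(1) by (simp add: power2_eq_square)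
        ultimately show ?thesis by (simp only: mult_1_right mult.assoc)
      qed
      also have "\<dots> \<le> s powr (- 2.483) * (2 * (s^2 / (2 * m * (s - 2 * m)) + 1/8))"
      proof (rule mult_left_mono)
        have "s^2 / (m * s) \<le> s^2 / (m * (s - 2 * m))"
          using s m mm by (intro divide_left_mono mult_left_mono mult_pos_pos) auto
        also have "\<dots> = 2 * (s^2 / (2 * m * (s - 2 * m)))" by simp
        finally show "s^2 / (m * s) \<le> 2 * (s^2 / (2 * m * (s - 2 * m)) + 1/8)"
          by (simp add: distrib_left)
      qed simp
      finally show "s powr (- 1.7415) * m powr (- 0.7415) \<le> 2 * potential s m"
        by (simp only: potential_def mult.left_commute)
    qed (rule K)
    finally show "3 * 3 powr 1.7415 * (8 / s) powr (2 - 1.7415) * sqrt (gram (q - p) (r - p)) powr (1.7415 - 1)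
        \<le> 6 * 3 powr 1.7415 * 8 powr 0.2585 * 32 powr 0.7415 * potential s m"
      by (simp add: K_def)
  qed
qed

text \<open>Each level replaces a cylinder by its three children, whose potentials sum to at most
  that of the parent.\<close>

lemma frame_has_cover:
  fixes a b c :: "real^3"
  defines "s \<equiv> mass a + mass b + mass c" and "m \<equiv> min (mass a) (min (mass b) (mass c))"
  assumes frame: "frame a b c" and m: "4 * m \<le> s"
    and G: "G \<subseteq> std_simplex" "G \<subseteq> (\<Union>j\<in>UNIV. rauzy_map j ` G)"
  shows "has_cover 1.7415 (24 / (s + 2 * real k))
    (6 * 3 powr 1.7415 * 8 powr 0.2585 * 32 powr 0.7415 * potential s m) (blend a b c ` G)"
  using frame m unfolding s_def m_def
proof (induction k arbitrary: a b c)
  case 0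
  then show ?case using frame_has_cover_base[of a b c G] G by simp
next
  case (Suc k)
  define K where "K = 6 * 3 powr 1.7415 * 8 powr 0.2585 * (32::real) powr 0.7415"
  define x y z where "x = mass a" and "y = mass b" and "z = mass c"
  define \<delta> where "\<delta> = 24 / (x + y + z + 2 * real (Suc k))"
  have F: "1 \<le> x" "1 \<le> y" "1 \<le> z" "x \<le> y + z" "y \<le> z + x" "z \<le> x + y"
    using Suc.prems(1) unfolding frame_def x_def y_def z_def by auto
  \<comment> \<open>\<open>t\<close> is the mass of the kept column, the least one in the child.
    There \<open>4 * t \<le> s + 2 * t\<close> follows from \<open>2 * t \<le> s\<close>, and
    \<open>1 \<le> t\<close> makes the total grow by at least \<open>2\<close>.\<close>
  have child: "has_cover 1.7415 \<delta> (K * potential (x + y + z + 2 * t) t) (blend a' b' c' ` G)"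
    if "frame a' b' c'" "min (mass a') (min (mass b') (mass c')) = t"
      "mass a' + mass b' + mass c' = x + y + z + 2 * t" "1 \<le> t" "2 * t \<le> x + y + z" for a' b' c' t
    using Suc.IH[OF that(1)] unfolding that(2,3) K_def[symmetric]
  proof (rule has_cover_mono)
    show "24 / (x + y + z + 2 * t + 2 * real k) \<le> \<delta>"
      unfolding \<delta>_def using F that by (intro divide_left_mono) auto
  qed (use that in auto)
  have ab: "frame a (a + b) (a + c)" "frame (a + b) b (b + c)" "frame (a + c) (b + c) c"
    using frame_child[OF Suc.prems(1)] frame_child[OF frame_rotate[OF Suc.prems(1)]]
      frame_child[OF frame_rotate[OF frame_rotate[OF Suc.prems(1)]]]
    by (metis frame_rotate add.commute)+
  have "has_cover 1.7415 \<delta> (K * potential (x + y + z + 2 * x) x) (blend a (a + b) (a + c) ` G)"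
    "has_cover 1.7415 \<delta> (K * potential (x + y + z + 2 * y) y) (blend (a + b) b (b + c) ` G)"
    "has_cover 1.7415 \<delta> (K * potential (x + y + z + 2 * z) z) (blend (a + c) (b + c) c ` G)"
    by (rule child[OF ab(1)] child[OF ab(2)] child[OF ab(3)];
        use F in \<open>auto simp: mass_add simp flip: x_def y_def z_def\<close>)+
  note covers = has_cover_Un[OF has_cover_Un[OF this(1,2)] this(3)]
  have sum: "potential (x + y + z + 2 * x) x + potential (x + y + z + 2 * y) y
      + potential (x + y + z + 2 * z) z \<le> potential (x + y + z) (min x (min y z))"
  proof -
    consider "min x (min y z) = x" | "min x (min y z) = y" | "min x (min y z) = z" by linarith
    then show ?thesis
      using Suc.prems(2) F potential_superharmonic[of x y z "x + y + z"]
        potential_superharmonic[of y x z "x + y + z"] potential_superharmonic[of z x y "x + y + z"]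
      unfolding x_def[symmetric] y_def[symmetric] z_def[symmetric] by cases auto
  qed
  have "has_cover 1.7415 \<delta> (K * potential (x + y + z) (min x (min y z))) (blend a b c ` G)"
  proof (rule has_cover_mono[OF covers blend_image_subset[OF G]])
    show "K * potential (x + y + z + 2 * x) x + K * potential (x + y + z + 2 * y) y
        + K * potential (x + y + z + 2 * z) z \<le> K * potential (x + y + z) (min x (min y z))"
      unfolding distrib_left[symmetric] using sum by (rule mult_left_mono) (simp add: K_def)
  qed simp
  then show ?case unfolding \<delta>_def K_def x_def y_def z_def .
qed

theorem theorem1p1:
  shows "hausdorff_dim rauzy_gasket \<le> ereal 1.7415"
proof -
  let ?e = "\<lambda>j. axis j 1 :: real^3"
  define G where "G = rauzy_gasket"
  have G: "G \<subseteq> std_simplex" "G \<subseteq> (\<Union>j\<in>UNIV. rauzy_map j ` G)"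
    using rauzy_gasket_subset rauzy_gasket_invariant by (auto simp: G_def)
  have mass_axis: "mass (?e j) = 1" for j
    using exhaust_3[of j] by (auto simp: mass_def axis_def)
  have dist_axis: "norm (?e i - ?e j) \<le> 2" for i j
    using norm_triangle_ineq4[of "?e i" "?e j"] by simp
  have frame: "frame (?e 1) (?e 2) (?e 3)"
    unfolding frame_def mass_axis using dist_axis by (simp add: triple_det_def axis_def)
  have blend: "blend (?e 1) (?e 2) (?e 3) x = x" if "x \<in> std_simplex" for x
    using that unfolding blend_def mass_axis by (simp add: std_simplex_def vec_eq_iff forall_3 axis_def)
  \<comment> \<open>The standard basis has masses \<open>1, 1, 1\<close> and violates
    \<open>4 * m \<le> s\<close>. Its three children have masses \<open>1, 2, 2\<close> in some
    order, so the covers start there, with \<open>s = 5\<close> and \<open>m = 1\<close>.\<close>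
  define K where "K = 6 * 3 powr 1.7415 * 8 powr 0.2585 * 32 powr 0.7415 * potential 5 1"
  define \<delta> where "\<delta> k = 24 / (5 + 2 * real k)" for k
  have cover: "has_cover 1.7415 (\<delta> k) (K + K + K) G" for k
  proof -
    note fs = frame_child[OF frame] frame_child[OF frame_rotate[OF frame]]
      frame_child[OF frame_rotate[OF frame_rotate[OF frame]]]
    have fs: "frame (?e 1) (?e 1 + ?e 2) (?e 1 + ?e 3)" "frame (?e 1 + ?e 2) (?e 2) (?e 2 + ?e 3)"
      "frame (?e 1 + ?e 3) (?e 2 + ?e 3) (?e 3)"
      using fs by (metis frame_rotate add.commute)+
    have "has_cover 1.7415 (\<delta> k) K (blend (?e 1) (?e 1 + ?e 2) (?e 1 + ?e 3) ` G)"
      "has_cover 1.7415 (\<delta> k) K (blend (?e 1 + ?e 2) (?e 2) (?e 2 + ?e 3) ` G)"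
      "has_cover 1.7415 (\<delta> k) K (blend (?e 1 + ?e 3) (?e 2 + ?e 3) (?e 3) ` G)"
      using frame_has_cover[OF fs(1) _ G, of k] frame_has_cover[OF fs(2) _ G, of k]
        frame_has_cover[OF fs(3) _ G, of k]
      by (simp_all add: mass_axis K_def \<delta>_def)
    note covers = has_cover_Un[OF has_cover_Un[OF this(1,2)] this(3)]
    have "blend (?e 1) (?e 2) (?e 3) ` G = G" using blend G(1) by force
    from blend_image_subset[OF G, of "?e 1" "?e 2" "?e 3", unfolded this]
    show ?thesis by (rule has_cover_mono[OF covers]) simp_all
  qed
  have "\<delta> \<longlonglongrightarrow> 0" unfolding \<delta>_def
    by (intro tendsto_divide_0[OF tendsto_const] filterlim_at_top_imp_at_infinity
        filterlim_tendsto_add_at_top[OF tendsto_const]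
        filterlim_tendsto_pos_mult_at_top[OF tendsto_const] filterlim_real_sequentially) simp
  then show ?thesis
    unfolding G_def[symmetric] using cover by (intro hausdorff_dim_le_if_has_cover) (auto simp: \<delta>_def)
qed

end
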